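(* Suppose that $Q\colon B^s_{p,q}\to b^s_{p,q}$ is surjective for all $p,q\in[1,\infty]$ and all $|s|<\overline s$. Let $p\in[1,2]$, let $D$ be a non-empty convex subset of $B^0_{p,1}$ with interior $D^\circ$ in $B^0_{p,1}$, let $Y$ be a Banach space and $F\colon D\to Y$. Let $\tilde p\in[p,2]$ and $a\in[d/p-d/\tilde p,\overline s)$. Assume that $F\colon D^\circ\to Y$ is Fréchet differentiable, and that $Y$ is uniformly smooth (e.g. a Hilbert space) or otherwise $F$ is linear. Let $g^{\mathrm{obs}}\in Y$, $\alpha>0$, and let $\hat f_\alpha\in D^\circ$ be a local minimizer over $D$ of $$f\mapsto\tfrac12\|F(f)-g^{\mathrm{obs}}\|_Y^2+\alpha\|f\|_{0,p,1}.$$ Suppose that the operator norm $K:=\|F'[\hat f_\alpha]\|_{B^{-a}_{\tilde p,1}\to Y}$ is finite (i.e. $F'[\hat f_\alpha]$ has a continuous extension to a bounded operator from $B^{-a}_{\tilde p,1}$ to $Y$ with norm $K$). Then for all $j\in\mathbb{N}_0$ $$Q_j\hat f_\alpha=0\qquad\text{if}\qquad\frac K\alpha\|F(\hat f_\alpha)-g^{\mathrm{obs}}\|_Y<2^{j\left(a+\frac d{\tilde p}-\frac dp\right)}.$$ In particular, at most a finite number of the wavelet coefficients $\langle\hat f_\alpha,\tilde\phi_\lambda\rangle$, $\lambda\in\Lambda$, do not vanish.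
   Context: $\Omega$ is either a bounded Lipschitz domain in $\mathbb{R}^d$ or the torus $(\mathbb{R}/\mathbb{Z})^d$. The index set is $\Lambda=\{(j,k)\colon j\in\mathbb{N}_0,k\in\Lambda_j\}$ with finite sets $\Lambda_j$ satisfying $2^{jd}\le|\Lambda_j|\le C_\Lambda2^{jd}$ for a constant $C_\Lambda\ge1$. $\{\phi_\lambda\}_{\lambda\in\Lambda}$ and $\{\tilde\phi_\lambda\}_{\lambda\in\Lambda}$ are wavelet frames in $L^2(\Omega)$ dual to each other, i.e. $\langle\phi_{j',k'},\tilde\phi_{j,k}\rangle_{L^2}=\delta_{jj'}\delta_{kk'}$, and each $\tilde\phi_\lambda$ belongs to $C^{\overline s}(\overline\Omega)$ for some $\overline s\in\mathbb{N}\cup\{\infty\}$. $\mathcal{D}^{\overline s}(\Omega)$ is the space of distributions of order $\le\overline s$ on $\mathbb{R}^d$ supported in $\overline\Omega$ (for the torus: periodic distributions of order $\le\overline s$). For $f\in\mathcal{D}^{\overline s}(\Omega)$ put $Q_jf:=(\langle f,\tilde\phi_{j,k}\rangle)_{k\in\Lambda_j}$ and $Qf:=(\langle f,\tilde\phi_{j,k}\rangle)_{(j,k)\in\Lambda}$. For $s\in\mathbb{R}$, $p,q\in[1,\infty]$, the sequence space $b^s_{p,q}$ consists of all $(z_\lambda)\in\mathbb{R}^\Lambda$ with $$\|(z_\lambda)\|_{b^s_{p,q}}:=\left\|\left(2^{js}2^{jd(\frac12-\frac1p)}\|(z_{j,k})_{k\in\Lambda_j}\|_p\right)_{j\in\mathbb{N}_0}\right\|_{\ell^q}<\infty,$$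 where $\|\cdot\|_p$ is the $\ell^p$-norm on $\mathbb{R}^{\Lambda_j}$, and $\|f\|_{s,p,q}:=\|Qf\|_{b^s_{p,q}}$, $B^s_{p,q}:=\{f\in\mathcal{D}^{\overline s}(\Omega)\colon\|f\|_{s,p,q}<\infty\}$, normed by $\|\cdot\|_{s,p,q}$.
   Formalization: The final claim that only finitely many wavelet coefficients do not vanish is stated only for a > d/p − d/p̃; at the endpoint a = d/p − d/p̃ it is false (e.g. p = p̃ = 1, a = 0, Y = ℝ, F(f) = Σ 2^{-jd/2}⟨f, φ̃_{j,k}⟩, g > α). *)

theory Defs
  imports "HOL-Analysis.Analysis" "HOL-Library.Function_Algebras" "HOL-Library.Extended_Nat"
begin

text \<open>Functions into a real vector space, with the pointwise operations. Distributions
  are functionals on real functions on \<open>\<real>\<^sup>d\<close>, so they live in such a vector space.\<close>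

instantiation "fun" :: (type, real_vector) real_vector
begin

definition scaleR_fun :: "real \<Rightarrow> ('a \<Rightarrow> 'b) \<Rightarrow> 'a \<Rightarrow> 'b"
  where "scaleR_fun c f = (\<lambda>x. c *\<^sub>R f x)"

instance
  by standard (simp_all add: scaleR_fun_def fun_eq_iff algebra_simps)

end

text \<open>The space \<open>\<real>\<^sup>d\<close> is the type \<open>'a :: euclidean_space\<close> with \<open>d = DIM('a)\<close>.
  Functions and distributions on the torus are identified with periodic ones on \<open>\<real>\<^sup>d\<close>.\<close>

datatype 'a spatial_domain = Domain "'a set" | Torus

text \<open>A point \<open>y\<close> is written in the coordinates \<open>y \<bullet> n\<close> and \<open>y - (y \<bullet> n) *\<^sub>R n\<close> (the projection onto
  the hyperplane orthogonal to \<open>n\<close>), so only the values of \<open>\<gamma>\<close> on that hyperplane are used.\<close>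

definition bounded_lipschitz_domain :: "'a::euclidean_space set \<Rightarrow> bool" where
  "bounded_lipschitz_domain U \<longleftrightarrow>
     U \<noteq> {} \<and> open U \<and> connected U \<and> bounded U \<and>
     (\<forall>x\<in>frontier U. \<exists>r>0. \<exists>n. norm n = 1 \<and>
        (\<exists>L \<gamma>. L-lipschitz_on {y. y \<bullet> n = 0} \<gamma> \<and>
          U \<inter> ball x r = {y \<in> ball x r. y \<bullet> n > (\<gamma> (y - (y \<bullet> n) *\<^sub>R n) :: real)}))"

fun valid_domain :: "'a::euclidean_space spatial_domain \<Rightarrow> bool" where
  "valid_domain (Domain U) \<longleftrightarrow> bounded_lipschitz_domain U"
| "valid_domain Torus \<longleftrightarrow> True"

definition periodic :: "('a::euclidean_space \<Rightarrow> real) \<Rightarrow> bool" where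
  "periodic g \<longleftrightarrow> (\<forall>i\<in>Basis. \<forall>x. g (x + i) = g x)"

definition integer_lattice :: "'a::euclidean_space set" where
  "integer_lattice = {z. \<forall>i\<in>Basis. z \<bullet> i \<in> \<int>}"

text \<open>For the torus, integration is over a fundamental cell.\<close>

fun region :: "'a::euclidean_space spatial_domain \<Rightarrow> 'a set" where
  "region (Domain U) = U"
| "region Torus = cbox 0 One"

definition L2_space :: "'a::euclidean_space spatial_domain \<Rightarrow> ('a \<Rightarrow> real) set" where
  "L2_space \<Omega> = {f \<in> borel_measurable (lebesgue_on (region \<Omega>)).
      integrable (lebesgue_on (region \<Omega>)) (\<lambda>x. (f x)\<^sup>2)}"

definition L2_inner :: "'a::euclidean_space spatial_domain \<Rightarrow> ('a \<Rightarrow> real) \<Rightarrow> ('a \<Rightarrow> real) \<Rightarrow> real" where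
  "L2_inner \<Omega> f g = (LINT x|lebesgue_on (region \<Omega>). f x * g x)"

definition L2_frame :: "'a::euclidean_space spatial_domain \<Rightarrow> 'i set \<Rightarrow> ('i \<Rightarrow> 'a \<Rightarrow> real) \<Rightarrow> bool" where
  "L2_frame \<Omega> I \<phi> \<longleftrightarrow> (\<forall>l\<in>I. \<phi> l \<in> L2_space \<Omega>) \<and>
     (\<exists>A>0. \<exists>B>0. \<forall>f\<in>L2_space \<Omega>.
        (\<lambda>l. (L2_inner \<Omega> f (\<phi> l))\<^sup>2) summable_on I \<and>
        A * L2_inner \<Omega> f f \<le> (\<Sum>\<^sub>\<infinity>l\<in>I. (L2_inner \<Omega> f (\<phi> l))\<^sup>2) \<and>
        (\<Sum>\<^sub>\<infinity>l\<in>I. (L2_inner \<Omega> f (\<phi> l))\<^sup>2) \<le> B * L2_inner \<Omega> f f)"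

primrec pderivs :: "'a::euclidean_space list \<Rightarrow> ('a \<Rightarrow> real) \<Rightarrow> 'a \<Rightarrow> real" where
  "pderivs [] f = f"
| "pderivs (i # is) f = (\<lambda>x. frechet_derivative (pderivs is f) (at x) i)"

definition C_space :: "enat \<Rightarrow> ('a::euclidean_space \<Rightarrow> real) set" where
  "C_space m = {f. \<forall>is. set is \<subseteq> Basis \<and> enat (length is) \<le> m \<longrightarrow>
      continuous_on UNIV (pderivs is f) \<and>
      (enat (length is) < m \<longrightarrow> (\<forall>x. pderivs is f differentiable at x))}"

definition supp :: "('a::euclidean_space \<Rightarrow> real) \<Rightarrow> 'a set" where
  "supp f = closure {x. f x \<noteq> 0}"

definition test_space :: "enat \<Rightarrow> ('a::euclidean_space \<Rightarrow> real) set" where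
  "test_space m = {f \<in> C_space m. compact (supp f)}"

text \<open>\<open>C\<^sup>m\<close> up to the boundary: restrictions of \<open>C\<^sup>m\<close> functions on \<open>\<real>\<^sup>d\<close>. Only the values of
  \<open>g\<close> on the closure of the domain are relevant.\<close>

fun C_closure :: "enat \<Rightarrow> 'a::euclidean_space spatial_domain \<Rightarrow> ('a \<Rightarrow> real) set" where
  "C_closure m (Domain U) = {g. \<exists>\<psi>\<in>C_space m. \<forall>x\<in>closure U. \<psi> x = g x}"
| "C_closure m Torus = {g \<in> C_space m. periodic g}"

type_synonym 'a functional = "('a \<Rightarrow> real) \<Rightarrow> real"

text \<open>Distributions of order at most \<open>m\<close> on \<open>\<real>\<^sup>d\<close>: the continuous linear functionals on the
  compactly supported \<open>C\<^sup>m\<close> functions (for \<open>m < \<infinity>\<close> these are the unique continuous extensions of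
  the distributions on compactly supported smooth functions which are of order at most \<open>m\<close>; for
  \<open>m = \<infinity>\<close> these are all distributions). The value off the test space is fixed to \<open>0\<close> so that
  equality of functionals is equality of distributions.\<close>

definition distributions :: "enat \<Rightarrow> 'a::euclidean_space functional set" where
  "distributions m = {T.
     (\<forall>\<psi>. \<psi> \<notin> test_space m \<longrightarrow> T \<psi> = 0) \<and>
     (\<forall>\<psi>\<in>test_space m. \<forall>\<eta>\<in>test_space m. T (\<lambda>x. \<psi> x + \<eta> x) = T \<psi> + T \<eta>) \<and>
     (\<forall>\<psi>\<in>test_space m. \<forall>c. T (\<lambda>x. c * \<psi> x) = c * T \<psi>) \<and>
     (\<forall>S. compact S \<longrightarrow> (\<exists>N C. enat N \<le> m \<and>
        (\<forall>\<psi>\<in>test_space m. \<forall>b. supp \<psi> \<subseteq> S \<and>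
           (\<forall>is x. set is \<subseteq> Basis \<and> length is \<le> N \<longrightarrow> \<bar>pderivs is \<psi> x\<bar> \<le> b)
           \<longrightarrow> \<bar>T \<psi>\<bar> \<le> C * b)))}"

fun distributions_on :: "enat \<Rightarrow> 'a::euclidean_space spatial_domain \<Rightarrow> 'a functional set" where
  "distributions_on m (Domain U) =
     {T \<in> distributions m. \<forall>\<psi>\<in>test_space m. supp \<psi> \<inter> closure U = {} \<longrightarrow> T \<psi> = 0}"
| "distributions_on m Torus =
     {T \<in> distributions m. \<forall>\<psi>\<in>test_space m. \<forall>i\<in>Basis. T (\<lambda>x. \<psi> (x + i)) = T \<psi>}"

text \<open>The pairing of \<open>T \<in> distributions_on m \<Omega>\<close> with \<open>g \<in> C_closure m \<Omega>\<close> is the value of \<open>T\<close> at any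
  test function that extends \<open>g\<close> (in case of a domain) respectively whose periodization is \<open>g\<close>
  (in case of the torus). The value does not depend on the representative.\<close>

fun represents :: "'a::euclidean_space spatial_domain \<Rightarrow> ('a \<Rightarrow> real) \<Rightarrow> ('a \<Rightarrow> real) \<Rightarrow> bool" where
  "represents (Domain U) \<psi> g \<longleftrightarrow> (\<forall>x\<in>closure U. \<psi> x = g x)"
| "represents Torus \<psi> g \<longleftrightarrow> (\<forall>x. ((\<lambda>z. \<psi> (x + z)) has_sum g x) integer_lattice)"

definition pairing ::
  "enat \<Rightarrow> 'a::euclidean_space spatial_domain \<Rightarrow> 'a functional \<Rightarrow> ('a \<Rightarrow> real) \<Rightarrow> real" where
  "pairing m \<Omega> T g = T (SOME \<psi>. \<psi> \<in> test_space m \<and> represents \<Omega> \<psi> g)"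

abbreviation index_set :: "(nat \<Rightarrow> 'k set) \<Rightarrow> (nat \<times> 'k) set" where
  "index_set \<Lambda> \<equiv> Sigma UNIV \<Lambda>"

definition wavelet_system ::
  "'a::euclidean_space spatial_domain \<Rightarrow> enat \<Rightarrow> (nat \<Rightarrow> 'k set) \<Rightarrow> real
     \<Rightarrow> (nat \<times> 'k \<Rightarrow> 'a \<Rightarrow> real) \<Rightarrow> (nat \<times> 'k \<Rightarrow> 'a \<Rightarrow> real) \<Rightarrow> bool" where
  "wavelet_system \<Omega> sbar \<Lambda> C \<phi> \<phi>' \<longleftrightarrow>
     valid_domain \<Omega> \<and> 1 \<le> sbar \<and> 1 \<le> C \<and>
     (\<forall>j. finite (\<Lambda> j) \<and> 2 ^ (j * DIM('a)) \<le> real (card (\<Lambda> j)) \<and>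
          real (card (\<Lambda> j)) \<le> C * 2 ^ (j * DIM('a))) \<and>
     L2_frame \<Omega> (index_set \<Lambda>) \<phi> \<and> L2_frame \<Omega> (index_set \<Lambda>) \<phi>' \<and>
     (\<forall>l\<in>index_set \<Lambda>. \<forall>l'\<in>index_set \<Lambda>. L2_inner \<Omega> (\<phi> l') (\<phi>' l) = (if l = l' then 1 else 0)) \<and>
     (\<forall>l\<in>index_set \<Lambda>. \<phi>' l \<in> C_closure sbar \<Omega>)"

definition in_ell :: "ereal \<Rightarrow> 'i set \<Rightarrow> ('i \<Rightarrow> real) \<Rightarrow> bool" where
  "in_ell p I z \<longleftrightarrow>
     (if p = \<infinity> then bdd_above ((\<lambda>i. \<bar>z i\<bar>) ` I)
      else (\<lambda>i. \<bar>z i\<bar> powr real_of_ereal p) summable_on I)"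

definition ell_norm :: "ereal \<Rightarrow> 'i set \<Rightarrow> ('i \<Rightarrow> real) \<Rightarrow> real" where
  "ell_norm p I z =
     (if p = \<infinity> then (SUP i\<in>I. \<bar>z i\<bar>)
      else (\<Sum>\<^sub>\<infinity>i\<in>I. \<bar>z i\<bar> powr real_of_ereal p) powr (1 / real_of_ereal p))"

definition level_norm ::
  "nat \<Rightarrow> (nat \<Rightarrow> 'k set) \<Rightarrow> real \<Rightarrow> ereal \<Rightarrow> (nat \<times> 'k \<Rightarrow> real) \<Rightarrow> nat \<Rightarrow> real" where
  "level_norm d \<Lambda> s p z j =
     2 powr (real j * s) * 2 powr (real j * real d * (1 / 2 - real_of_ereal (1 / p)))
       * ell_norm p (\<Lambda> j) (\<lambda>k. z (j, k))"

text \<open>The first argument \<open>d\<close> is the space dimension. Elements of \<open>\<real>\<^sup>\<Lambda>\<close> are the functions that are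
  \<open>extensional\<close> on the index set.\<close>

definition b_space ::
  "nat \<Rightarrow> (nat \<Rightarrow> 'k set) \<Rightarrow> real \<Rightarrow> ereal \<Rightarrow> ereal \<Rightarrow> (nat \<times> 'k \<Rightarrow> real) set" where
  "b_space d \<Lambda> s p q = {z \<in> extensional (index_set \<Lambda>). in_ell q UNIV (level_norm d \<Lambda> s p z)}"

definition b_norm ::
  "nat \<Rightarrow> (nat \<Rightarrow> 'k set) \<Rightarrow> real \<Rightarrow> ereal \<Rightarrow> ereal \<Rightarrow> (nat \<times> 'k \<Rightarrow> real) \<Rightarrow> real" where
  "b_norm d \<Lambda> s p q z = ell_norm q UNIV (level_norm d \<Lambda> s p z)"

definition Q_level ::
  "'a::euclidean_space spatial_domain \<Rightarrow> enat \<Rightarrow> (nat \<Rightarrow> 'k set) \<Rightarrow> (nat \<times> 'k \<Rightarrow> 'a \<Rightarrow> real)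
     \<Rightarrow> nat \<Rightarrow> 'a functional \<Rightarrow> 'k \<Rightarrow> real" where
  "Q_level \<Omega> sbar \<Lambda> \<phi>' j f = restrict (\<lambda>k. pairing sbar \<Omega> f (\<phi>' (j, k))) (\<Lambda> j)"

definition Q_map ::
  "'a::euclidean_space spatial_domain \<Rightarrow> enat \<Rightarrow> (nat \<Rightarrow> 'k set) \<Rightarrow> (nat \<times> 'k \<Rightarrow> 'a \<Rightarrow> real)
     \<Rightarrow> 'a functional \<Rightarrow> nat \<times> 'k \<Rightarrow> real" where
  "Q_map \<Omega> sbar \<Lambda> \<phi>' f = restrict (\<lambda>l. pairing sbar \<Omega> f (\<phi>' l)) (index_set \<Lambda>)"

definition B_norm ::
  "'a::euclidean_space spatial_domain \<Rightarrow> enat \<Rightarrow> (nat \<Rightarrow> 'k set) \<Rightarrow> (nat \<times> 'k \<Rightarrow> 'a \<Rightarrow> real)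
     \<Rightarrow> real \<Rightarrow> ereal \<Rightarrow> ereal \<Rightarrow> 'a functional \<Rightarrow> real" where
  "B_norm \<Omega> sbar \<Lambda> \<phi>' s p q f = b_norm DIM('a) \<Lambda> s p q (Q_map \<Omega> sbar \<Lambda> \<phi>' f)"

definition B_space ::
  "'a::euclidean_space spatial_domain \<Rightarrow> enat \<Rightarrow> (nat \<Rightarrow> 'k set) \<Rightarrow> (nat \<times> 'k \<Rightarrow> 'a \<Rightarrow> real)
     \<Rightarrow> real \<Rightarrow> ereal \<Rightarrow> ereal \<Rightarrow> 'a functional set" where
  "B_space \<Omega> sbar \<Lambda> \<phi>' s p q =
     {f \<in> distributions_on sbar \<Omega>. Q_map \<Omega> sbar \<Lambda> \<phi>' f \<in> b_space DIM('a) \<Lambda> s p q}"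

text \<open>The spaces \<open>B_space\<close> depend on term parameters, so the following notions are relative to a
  carrier \<open>V\<close> (a linear subspace) and a norm \<open>N\<close> on it.\<close>

definition carrier_interior :: "'v::real_vector set \<Rightarrow> ('v \<Rightarrow> real) \<Rightarrow> 'v set \<Rightarrow> 'v set" where
  "carrier_interior V N D = {f \<in> V. \<exists>r>0. \<forall>g\<in>V. N (g - f) < r \<longrightarrow> g \<in> D}"

definition linear_on_carrier :: "'v::real_vector set \<Rightarrow> ('v \<Rightarrow> 'y::real_vector) \<Rightarrow> bool" where
  "linear_on_carrier V A \<longleftrightarrow>
     (\<forall>f\<in>V. \<forall>g\<in>V. A (f + g) = A f + A g) \<and> (\<forall>f\<in>V. \<forall>c. A (c *\<^sub>R f) = c *\<^sub>R A f)"

definition bounded_linear_on_carrier ::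
  "'v::real_vector set \<Rightarrow> ('v \<Rightarrow> real) \<Rightarrow> ('v \<Rightarrow> 'y::real_normed_vector) \<Rightarrow> bool" where
  "bounded_linear_on_carrier V N A \<longleftrightarrow>
     linear_on_carrier V A \<and> (\<exists>C. \<forall>f\<in>V. norm (A f) \<le> C * N f)"

definition operator_norm ::
  "'v::real_vector set \<Rightarrow> ('v \<Rightarrow> real) \<Rightarrow> ('v \<Rightarrow> 'y::real_normed_vector) \<Rightarrow> real" where
  "operator_norm V N A = (SUP f\<in>{f \<in> V. N f \<le> 1}. norm (A f))"

text \<open>Used only at points \<open>f\<close> of the interior of the domain of \<open>F\<close>, so that \<open>F (f + h)\<close> is meaningful
  for all small \<open>h\<close>.\<close>

definition has_frechet_derivative ::
  "'v::real_vector set \<Rightarrow> ('v \<Rightarrow> real) \<Rightarrow> ('v \<Rightarrow> 'y::real_normed_vector) \<Rightarrow> ('v \<Rightarrow> 'y) \<Rightarrow> 'v \<Rightarrow> bool" where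
  "has_frechet_derivative V N F A f \<longleftrightarrow> bounded_linear_on_carrier V N A \<and>
     (\<forall>\<epsilon>>0. \<exists>\<delta>>0. \<forall>h\<in>V. N h < \<delta> \<longrightarrow> norm (F (f + h) - F f - A h) \<le> \<epsilon> * N h)"

definition local_minimizer_on ::
  "('v::real_vector \<Rightarrow> real) \<Rightarrow> 'v set \<Rightarrow> ('v \<Rightarrow> real) \<Rightarrow> 'v \<Rightarrow> bool" where
  "local_minimizer_on N D J f \<longleftrightarrow>
     f \<in> D \<and> (\<exists>r>0. \<forall>g\<in>D. N (g - f) < r \<longrightarrow> J f \<le> J g)"

text \<open>The modulus of smoothness
  \<open>\<rho>(\<tau>) = sup {(\<parallel>x + \<tau>y\<parallel> + \<parallel>x - \<tau>y\<parallel>)/2 - 1 | \<parallel>x\<parallel> = \<parallel>y\<parallel> = 1}\<close> satisfies \<open>\<rho>(\<tau>)/\<tau> \<rightarrow> 0\<close> as \<open>\<tau> \<rightarrow> 0\<close>.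
  The supremum is unfolded to cover the trivial space, which has no unit vectors.\<close>

definition uniformly_smooth :: "'y::real_normed_vector itself \<Rightarrow> bool" where
  "uniformly_smooth _ \<longleftrightarrow>
     (\<forall>\<epsilon>>0. \<exists>\<delta>>0. \<forall>\<tau>. 0 < \<tau> \<and> \<tau> < \<delta> \<longrightarrow>
        (\<forall>x y :: 'y. norm x = 1 \<and> norm y = 1 \<longrightarrow>
           (norm (x + \<tau> *\<^sub>R y) + norm (x - \<tau> *\<^sub>R y)) / 2 - 1 \<le> \<epsilon> * \<tau>))"

end

theory Submission
  imports Defs
begin

text \<open>Shrink the level-\<open>j\<close> coefficients of the minimizer: let \<open>v\<close> be a distribution whose
  coefficients are those of \<open>fhat\<close> on level \<open>j\<close> and \<open>0\<close> elsewhere. The penalty is an \<open>\<ell>\<^sup>1\<close>-sum over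
  levels, so along \<open>fhat - t v\<close> it decreases at the exact rate \<open>\<alpha> \<parallel>v\<parallel>\<close>, whereas the data term
  increases at rate at most \<open>\<parallel>F fhat - gobs\<parallel> \<parallel>F'[fhat] v\<parallel>\<close> by the triangle inequality alone.
  Minimality gives \<open>\<alpha> \<parallel>v\<parallel>\<^bsub>0,p,1\<^esub> \<le> K \<parallel>F fhat - gobs\<parallel> \<parallel>v\<parallel>\<^bsub>-a,pt,1\<^esub>\<close>, and on a single level the two
  norms are comparable with the explicit factor \<open>2 powr (- j (a + d/pt - d/p))\<close> since
  \<open>\<ell>\<^sup>p \<subseteq> \<ell>\<^bsup>pt\<^esup>\<close> contractively.\<close>

section \<open>Linear structure of the spaces of distributions\<close>

text \<open>Isolates the continuity estimate on one compact set, so that orders and constants of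
  several distributions can be combined without reopening the quantifiers in
  \<open>distributions\<close>.\<close>

definition order_bound ::
  "enat \<Rightarrow> 'a::euclidean_space functional \<Rightarrow> 'a set \<Rightarrow> nat \<Rightarrow> real \<Rightarrow> bool" where
  "order_bound m T X N C \<longleftrightarrow>
     (\<forall>\<psi>\<in>test_space m. \<forall>b. supp \<psi> \<subseteq> X \<and>
        (\<forall>is x. set is \<subseteq> Basis \<and> length is \<le> N \<longrightarrow> \<bar>pderivs is \<psi> x\<bar> \<le> b)
        \<longrightarrow> \<bar>T \<psi>\<bar> \<le> C * b)"

lemma distributions_iff:
  "T \<in> distributions m \<longleftrightarrow>
     (\<forall>\<psi>. \<psi> \<notin> test_space m \<longrightarrow> T \<psi> = 0) \<and>
     (\<forall>\<psi>\<in>test_space m. \<forall>\<eta>\<in>test_space m. T (\<lambda>x. \<psi> x + \<eta> x) = T \<psi> + T \<eta>) \<and>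
     (\<forall>\<psi>\<in>test_space m. \<forall>c. T (\<lambda>x. c * \<psi> x) = c * T \<psi>) \<and>
     (\<forall>X. compact X \<longrightarrow> (\<exists>N C. enat N \<le> m \<and> order_bound m T X N C))"
  unfolding distributions_def order_bound_def mem_Collect_eq by (rule refl)

lemma distributions_order_bound:
  assumes "T \<in> distributions m" "compact X"
  obtains N C where "enat N \<le> m" "order_bound m T X N C"
proof -
  have "\<forall>X. compact X \<longrightarrow> (\<exists>N C. enat N \<le> m \<and> order_bound m T X N C)"
    using assms(1) unfolding distributions_iff by (elim conjE)
  then show thesis using assms(2) that by blast
qed

text \<open>Control of the derivatives up to the larger order includes what either summand needs, so
  both estimates apply with the same \<open>b\<close>.\<close>

lemma order_bound_add:
  assumes "order_bound m S X N1 C1" "order_bound m T X N2 C2"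
  shows "order_bound m (S + T) X (max N1 N2) (C1 + C2)"
  unfolding order_bound_def
proof (intro ballI allI impI)
  fix \<psi> b
  assume \<psi>: "\<psi> \<in> test_space m" and *: "supp \<psi> \<subseteq> X \<and>
     (\<forall>is x. set is \<subseteq> Basis \<and> length is \<le> max N1 N2 \<longrightarrow> \<bar>pderivs is \<psi> x\<bar> \<le> b)"
  have "\<bar>S \<psi>\<bar> \<le> C1 * b"
    using * by (intro assms(1)[unfolded order_bound_def, rule_format, OF \<psi>]) auto
  moreover have "\<bar>T \<psi>\<bar> \<le> C2 * b"
    using * by (intro assms(2)[unfolded order_bound_def, rule_format, OF \<psi>]) auto
  ultimately show "\<bar>(S + T) \<psi>\<bar> \<le> (C1 + C2) * b" by (simp add: algebra_simps)
qed

lemma order_bound_scaleR: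
  assumes "order_bound m T X N C"
  shows "order_bound m (c *\<^sub>R T) X N (\<bar>c\<bar> * C)"
  unfolding order_bound_def
proof (intro ballI allI impI)
  fix \<psi> b
  assume \<psi>: "\<psi> \<in> test_space m" and *: "supp \<psi> \<subseteq> X \<and>
     (\<forall>is x. set is \<subseteq> Basis \<and> length is \<le> N \<longrightarrow> \<bar>pderivs is \<psi> x\<bar> \<le> b)"
  have "\<bar>T \<psi>\<bar> \<le> C * b"
    using * by (intro assms[unfolded order_bound_def, rule_format, OF \<psi>]) auto
  then have "\<bar>c\<bar> * \<bar>T \<psi>\<bar> \<le> \<bar>c\<bar> * (C * b)" by (rule mult_left_mono) simp
  then show "\<bar>(c *\<^sub>R T) \<psi>\<bar> \<le> \<bar>c\<bar> * C * b"
    by (simp add: scaleR_fun_def abs_mult mult.assoc)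
qed

lemma subspace_distributions: "subspace (distributions m)"
proof (rule subspaceI)
  have "enat 0 \<le> m \<and> order_bound m 0 X 0 0" for X
    by (simp add: order_bound_def zero_enat_def[symmetric])
  then show "0 \<in> distributions m"
    by (auto simp: distributions_iff)
next
  fix S T :: "'a functional"
  assume S: "S \<in> distributions m" and T: "T \<in> distributions m"
  have "\<exists>N C. enat N \<le> m \<and> order_bound m (S + T) X N C" if "compact X" for X
  proof -
    obtain N1 C1 where "enat N1 \<le> m" "order_bound m S X N1 C1"
      by (rule distributions_order_bound[OF S \<open>compact X\<close>])
    moreover obtain N2 C2 where "enat N2 \<le> m" "order_bound m T X N2 C2"
      by (rule distributions_order_bound[OF T \<open>compact X\<close>])
    \<comment> \<open>The maximum is one of the two orders, so it still respects
      \<open>m\<close>.\<close>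
    ultimately have "enat (max N1 N2) \<le> m \<and> order_bound m (S + T) X (max N1 N2) (C1 + C2)"
      using order_bound_add[of m S X N1 C1 T N2 C2] by (cases "N1 \<le> N2") (auto simp: max_def)
    then show ?thesis by blast
  qed
  then show "S + T \<in> distributions m"
    using S T unfolding distributions_iff by (simp add: algebra_simps)
next
  fix c :: real and T :: "'a functional"
  assume T: "T \<in> distributions m"
  then have "\<exists>N C. enat N \<le> m \<and> order_bound m (c *\<^sub>R T) X N C" if "compact X" for X
    using that order_bound_scaleR distributions_order_bound by metis
  then show "c *\<^sub>R T \<in> distributions m"
    using T unfolding distributions_iff by (simp add: algebra_simps scaleR_fun_def)
qed

text \<open>The support condition and the periodicity condition are both linear and homogeneous in
  \<open>T\<close>. The subspace property keeps the perturbed minimizer a distribution, which its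
  coefficients alone would not show.\<close>

lemma subspace_distributions_on: "subspace (distributions_on m \<Omega>)"
proof (cases \<Omega>)
  case (Domain U)
  show ?thesis
    using subspace_distributions[of m] unfolding Domain subspace_def
    by (auto simp: scaleR_fun_def)
next
  case Torus
  show ?thesis
    using subspace_distributions[of m] unfolding Torus subspace_def
    by (auto simp: scaleR_fun_def)
qed

text \<open>The representative chosen in \<open>pairing\<close> does not depend on the distribution, so linearity
  holds even where no representative exists.\<close>

lemma Q_map_add_scaleR:
  "l \<in> index_set \<Lambda> \<Longrightarrow>
   Q_map \<Omega> m \<Lambda> \<phi>' (f + c *\<^sub>R g) l = Q_map \<Omega> m \<Lambda> \<phi>' f l + c * Q_map \<Omega> m \<Lambda> \<phi>' g l"
  by (auto simp: Q_map_def pairing_def scaleR_fun_def)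

lemma Q_map_scaleR:
  "l \<in> index_set \<Lambda> \<Longrightarrow> Q_map \<Omega> m \<Lambda> \<phi>' (c *\<^sub>R g) l = c * Q_map \<Omega> m \<Lambda> \<phi>' g l"
  by (auto simp: Q_map_def pairing_def scaleR_fun_def)

section \<open>Sequence norms with finite exponent\<close>

lemma ell_norm_ereal:
  "ell_norm (ereal p) I z = (\<Sum>\<^sub>\<infinity>i\<in>I. \<bar>z i\<bar> powr p) powr (1 / p)"
  by (simp add: ell_norm_def)

lemma ell_norm_1: "ell_norm 1 I z = (\<Sum>\<^sub>\<infinity>i\<in>I. \<bar>z i\<bar>)"
  by (simp add: ell_norm_def infsum_nonneg)

lemma in_ell_1: "in_ell 1 I z \<longleftrightarrow> (\<lambda>i. \<bar>z i\<bar>) summable_on I"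
  by (simp add: in_ell_def)

lemma ell_norm_cmult:
  assumes "0 < p"
  shows "ell_norm (ereal p) I (\<lambda>i. c * z i) = \<bar>c\<bar> * ell_norm (ereal p) I z"
proof -
  have "(\<Sum>\<^sub>\<infinity>i\<in>I. \<bar>c * z i\<bar> powr p) = \<bar>c\<bar> powr p * (\<Sum>\<^sub>\<infinity>i\<in>I. \<bar>z i\<bar> powr p)"
    by (simp add: abs_mult powr_mult infsum_cmult_right')
  then show ?thesis
    using assms by (simp add: ell_norm_ereal powr_mult infsum_nonneg powr_powr)
qed

text \<open>With \<open>S\<close> the norm of exponent \<open>p\<close>, every entry is at most
  \<open>S\<close> in modulus, so its power \<open>q\<close> is at most
  \<open>S powr (q - p)\<close> times its power \<open>p\<close>. Summation gives
  \<open>S powr q\<close>.\<close>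

lemma ell_norm_antimono_exponent:
  assumes "finite I" "0 < p" "p \<le> q"
  shows "ell_norm (ereal q) I z \<le> ell_norm (ereal p) I z"
proof -
  define S where "S = ell_norm (ereal p) I z"
  have S: "S = (\<Sum>i\<in>I. \<bar>z i\<bar> powr p) powr (1 / p)"
    using assms(1) by (simp add: S_def ell_norm_ereal)
  have Sp: "S powr p = (\<Sum>i\<in>I. \<bar>z i\<bar> powr p)"
    using assms by (simp add: S powr_powr sum_nonneg)
  have le: "\<bar>z i\<bar> \<le> S" if "i \<in> I" for i
  proof -
    have "\<bar>z i\<bar> powr p \<le> S powr p"
      unfolding Sp using that assms(1) by (intro member_le_sum) auto
    then show ?thesis
      using assms(2) powr_less_mono2[of p S "\<bar>z i\<bar>"] by (fastforce simp: S)
  qed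
  have "\<bar>z i\<bar> powr q \<le> S powr (q - p) * \<bar>z i\<bar> powr p" if "i \<in> I" for i
  proof -
    \<comment> \<open>Since \<open>0 powr y = 0\<close> for every \<open>y\<close>, including
      \<open>y = 0\<close>, the splitting also holds for a vanishing entry.\<close>
    have "\<bar>z i\<bar> powr q = \<bar>z i\<bar> powr (q - p) * \<bar>z i\<bar> powr p"
      by (simp add: powr_add[symmetric])
    also have "\<dots> \<le> S powr (q - p) * \<bar>z i\<bar> powr p"
      using le[OF that] assms(3) by (intro mult_right_mono powr_mono2) auto
    finally show ?thesis .
  qed
  then have "(\<Sum>i\<in>I. \<bar>z i\<bar> powr q) \<le> (\<Sum>i\<in>I. S powr (q - p) * \<bar>z i\<bar> powr p)"
    by (rule sum_mono)
  also have "\<dots> = S powr q"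
    by (simp add: sum_distrib_left[symmetric] Sp[symmetric] powr_add[symmetric])
  finally have "(\<Sum>i\<in>I. \<bar>z i\<bar> powr q) powr (1 / q) \<le> (S powr q) powr (1 / q)"
    using assms by (intro powr_mono2) (auto intro: sum_nonneg)
  also have "\<dots> = S"
    using assms by (simp add: powr_powr S)
  finally show ?thesis
    using assms(1) by (simp add: ell_norm_ereal S_def)
qed

section \<open>Weighted norms of a single level\<close>

lemma level_norm_ereal:
  assumes "0 < p"
  shows "level_norm d \<Lambda> s (ereal p) z j
    = 2 powr (real j * s) * 2 powr (real j * real d * (1 / 2 - 1 / p))
      * ell_norm (ereal p) (\<Lambda> j) (\<lambda>k. z (j, k))"
  using assms by (simp add: level_norm_def one_ereal_def)

lemma level_norm_nonneg: "0 \<le> level_norm d \<Lambda> s (ereal p) z j"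
  by (simp add: level_norm_def ell_norm_ereal)

lemma level_norm_cmult:
  assumes "0 < p" "\<And>k. k \<in> \<Lambda> j \<Longrightarrow> w (j, k) = c * z (j, k)"
  shows "level_norm d \<Lambda> s (ereal p) w j = \<bar>c\<bar> * level_norm d \<Lambda> s (ereal p) z j"
proof -
  have "ell_norm (ereal p) (\<Lambda> j) (\<lambda>k. w (j, k)) = ell_norm (ereal p) (\<Lambda> j) (\<lambda>k. c * z (j, k))"
    unfolding ell_norm_ereal using assms(2) by (simp cong: infsum_cong)
  then show ?thesis
    by (simp add: level_norm_def ell_norm_cmult[OF assms(1)])
qed

lemma level_norm_eq_0_iff:
  assumes "0 < p" "finite (\<Lambda> j)"
  shows "level_norm d \<Lambda> s (ereal p) z j = 0 \<longleftrightarrow> (\<forall>k\<in>\<Lambda> j. z (j, k) = 0)"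
  using assms by (simp add: level_norm_def ell_norm_ereal sum_nonneg_eq_0_iff)

text \<open>The three powers of two on the left combine to the weight of the right-hand norm, since
  the terms in \<open>a\<close> and \<open>d / q\<close> cancel. What remains is the contractive
  inclusion between sequence norms on a finite level.\<close>

lemma level_norm_embedding:
  assumes "0 < p" "p \<le> q" "finite (\<Lambda> j)"
  shows "2 powr (real j * (a + real d / q - real d / p)) * level_norm d \<Lambda> (- a) (ereal q) z j
         \<le> level_norm d \<Lambda> 0 (ereal p) z j"
proof -
  have "2 powr (real j * (a + real d / q - real d / p)) * level_norm d \<Lambda> (- a) (ereal q) z j
      = 2 powr (real j * (a + real d / q - real d / p) + real j * (- a)
          + real j * real d * (1 / 2 - 1 / q)) * ell_norm (ereal q) (\<Lambda> j) (\<lambda>k. z (j, k))"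
    using assms by (simp only: level_norm_ereal powr_add mult.assoc)
  also have "real j * (a + real d / q - real d / p) + real j * (- a)
          + real j * real d * (1 / 2 - 1 / q) = real j * real d * (1 / 2 - 1 / p)"
    by (simp add: algebra_simps)
  also have "2 powr (real j * real d * (1 / 2 - 1 / p)) * ell_norm (ereal q) (\<Lambda> j) (\<lambda>k. z (j, k))
      \<le> 2 powr (real j * real d * (1 / 2 - 1 / p)) * ell_norm (ereal p) (\<Lambda> j) (\<lambda>k. z (j, k))"
    using assms by (intro mult_left_mono ell_norm_antimono_exponent) auto
  also have "\<dots> = level_norm d \<Lambda> 0 (ereal p) z j"
    using assms by (simp add: level_norm_ereal)
  finally show ?thesis .
qed

section \<open>Sequence spaces that are summable over the levels\<close>

lemma b_norm_1:
  "b_norm d \<Lambda> s (ereal p) 1 z = (\<Sum>\<^sub>\<infinity>i. level_norm d \<Lambda> s (ereal p) z i)"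
  by (simp add: b_norm_def ell_norm_1 level_norm_nonneg)

lemma b_space_1:
  "z \<in> b_space d \<Lambda> s (ereal p) 1 \<longleftrightarrow>
   z \<in> extensional (index_set \<Lambda>) \<and> level_norm d \<Lambda> s (ereal p) z summable_on UNIV"
  by (simp add: b_space_def in_ell_1 level_norm_nonneg)

lemma b_norm_1_nonneg: "0 \<le> b_norm d \<Lambda> s (ereal p) 1 z"
  by (simp add: b_norm_1 infsum_nonneg level_norm_nonneg)

text \<open>The series over the levels has one possibly nonzero term, so \<open>s\<close> and
  \<open>p\<close> are arbitrary. This gives both norms of the test direction, with parameters
  \<open>0, p\<close> and \<open>- a, pt\<close>.\<close>

lemma b_single_level:
  assumes "0 < p" "w \<in> extensional (index_set \<Lambda>)"
    and "\<And>i k. k \<in> \<Lambda> i \<Longrightarrow> w (i, k) = (if i = j then z (i, k) else 0)"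
  shows "w \<in> b_space d \<Lambda> s (ereal p) 1"
    and "b_norm d \<Lambda> s (ereal p) 1 w = level_norm d \<Lambda> s (ereal p) z j"
proof -
  have "level_norm d \<Lambda> s (ereal p) w i = (if i = j then level_norm d \<Lambda> s (ereal p) z i else 0)" for i
    using level_norm_cmult[OF assms(1), of \<Lambda> i w "if i = j then 1 else 0" z d s] assms(3)
    by auto
  then have "(level_norm d \<Lambda> s (ereal p) w has_sum level_norm d \<Lambda> s (ereal p) z j) UNIV"
    using has_sum_finite_neutralI[of "{j}" UNIV "level_norm d \<Lambda> s (ereal p) w"] by simp
  then show "w \<in> b_space d \<Lambda> s (ereal p) 1"
    and "b_norm d \<Lambda> s (ereal p) 1 w = level_norm d \<Lambda> s (ereal p) z j"
    using assms(2) by (auto simp: b_space_1 b_norm_1 has_sum_imp_summable infsumI)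
qed

lemma b_cmult:
  assumes "0 < p" "w \<in> extensional (index_set \<Lambda>)" "z \<in> b_space d \<Lambda> s (ereal p) 1"
    and "\<And>l. l \<in> index_set \<Lambda> \<Longrightarrow> w l = c * z l"
  shows "w \<in> b_space d \<Lambda> s (ereal p) 1"
    and "b_norm d \<Lambda> s (ereal p) 1 w = \<bar>c\<bar> * b_norm d \<Lambda> s (ereal p) 1 z"
proof -
  have "level_norm d \<Lambda> s (ereal p) w = (\<lambda>i. \<bar>c\<bar> * level_norm d \<Lambda> s (ereal p) z i)"
    using level_norm_cmult[OF assms(1), of \<Lambda> _ w c z d s] assms(4) by (auto simp: fun_eq_iff)
  then show "w \<in> b_space d \<Lambda> s (ereal p) 1"
    and "b_norm d \<Lambda> s (ereal p) 1 w = \<bar>c\<bar> * b_norm d \<Lambda> s (ereal p) 1 z"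
    using assms(2,3) by (auto simp: b_space_1 b_norm_1 summable_on_cmult_right infsum_cmult_right')
qed

text \<open>Because the levels are summed, only the term of level \<open>j\<close> changes. The
  bound \<open>t \<le> 1\<close> makes \<open>1 - t\<close> its own absolute value, so the norm is
  exactly affine in \<open>t\<close>.\<close>

lemma b_shrink_level:
  assumes "0 < p" "w \<in> extensional (index_set \<Lambda>)" "z \<in> b_space d \<Lambda> s (ereal p) 1" "t \<le> 1"
    and "\<And>i k. k \<in> \<Lambda> i \<Longrightarrow> w (i, k) = (if i = j then (1 - t) * z (i, k) else z (i, k))"
  shows "w \<in> b_space d \<Lambda> s (ereal p) 1"
    and "b_norm d \<Lambda> s (ereal p) 1 w
         = b_norm d \<Lambda> s (ereal p) 1 z - t * level_norm d \<Lambda> s (ereal p) z j"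
proof -
  let ?L = "level_norm d \<Lambda> s (ereal p)"
  \<comment> \<open>The change of the level norms is a sequence with support in \<open>{j}\<close>,
    so its sum is immediate.\<close>
  define u where "u i = (if i = j then - t * ?L z j else 0)" for i
  have u: "(u has_sum - t * ?L z j) UNIV"
    using has_sum_finite_neutralI[of "{j}" UNIV u] by (simp add: u_def)
  have "?L w = (\<lambda>i. ?L z i + u i)"
  proof
    fix i
    show "?L w i = ?L z i + u i"
      using level_norm_cmult[OF assms(1), of \<Lambda> i w "if i = j then 1 - t else 1" z d s] assms(4,5)
      by (auto simp: u_def algebra_simps)
  qed
  moreover have "(?L z has_sum b_norm d \<Lambda> s (ereal p) 1 z) UNIV"
    using assms(3) by (simp add: b_space_1 b_norm_1)
  ultimately have "(?L w has_sum b_norm d \<Lambda> s (ereal p) 1 z - t * ?L z j) UNIV"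
    using has_sum_add[OF _ u, of "?L z"] by simp
  then show "w \<in> b_space d \<Lambda> s (ereal p) 1"
    and "b_norm d \<Lambda> s (ereal p) 1 w
         = b_norm d \<Lambda> s (ereal p) 1 z - t * level_norm d \<Lambda> s (ereal p) z j"
    using assms(2) by (auto simp: b_space_1 b_norm_1[of _ _ _ _ w] has_sum_imp_summable infsumI)
qed

section \<open>Operator norm and first-order optimality\<close>

text \<open>If \<open>N v\<close> is positive, normalise \<open>v\<close>. If it is zero,
  boundedness forces \<open>A v = 0\<close>; \<open>N\<close> may vanish at nonzero vectors, as
  wavelet coefficients are not assumed to determine a distribution.\<close>

lemma norm_le_operator_norm:
  assumes A: "bounded_linear_on_carrier V N A" and v: "v \<in> V"
    and nonneg: "\<And>f. f \<in> V \<Longrightarrow> 0 \<le> N f"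
    and scale: "\<And>c. c *\<^sub>R v \<in> V" "\<And>c. N (c *\<^sub>R v) = \<bar>c\<bar> * N v"
  shows "norm (A v) \<le> operator_norm V N A * N v"
proof -
  obtain C where C: "\<And>f. f \<in> V \<Longrightarrow> norm (A f) \<le> C * N f"
    using A unfolding bounded_linear_on_carrier_def by blast
  show ?thesis
  proof (cases "N v = 0")
    case True
    then show ?thesis using C[OF v] by simp
  next
    case False
    then have pos: "0 < N v" using nonneg[OF v] by simp
    let ?u = "inverse (N v) *\<^sub>R v"
    \<comment> \<open>Boundedness is what makes the real supremum an upper bound. The constant
      \<open>C\<close> may be negative, hence its absolute value.\<close>
    have "bdd_above ((\<lambda>f. norm (A f)) ` {f \<in> V. N f \<le> 1})"
    proof (rule bdd_aboveI2)
      fix f assume "f \<in> {f \<in> V. N f \<le> 1}"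
      then have f: "f \<in> V" "N f \<le> 1" by auto
      have "norm (A f) \<le> \<bar>C\<bar> * N f"
        using C[OF f(1)] mult_right_mono[OF abs_ge_self nonneg[OF f(1)], of C] by simp
      also have "\<dots> \<le> \<bar>C\<bar>" using f(2) by (simp add: mult_left_le)
      finally show "norm (A f) \<le> \<bar>C\<bar>" .
    qed
    then have "norm (A ?u) \<le> operator_norm V N A"
      unfolding operator_norm_def using scale pos by (intro cSUP_upper) auto
    also have "A ?u = inverse (N v) *\<^sub>R A v"
      using A v unfolding bounded_linear_on_carrier_def linear_on_carrier_def by blast
    finally show ?thesis using pos by (simp add: field_simps)
  qed
qed

text \<open>Compare \<open>f\<close> with \<open>f - t v\<close>. The penalty drops by exactly
  \<open>t * \<alpha> * N v\<close>, while the residual norm grows by at most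
  \<open>t * (norm (A v) + \<epsilon> * N v)\<close>. Divide by \<open>t\<close>, let
  \<open>t\<close> tend to 0, then \<epsilon>.\<close>

lemma local_minimizer_first_order:
  fixes F :: "'v::real_vector \<Rightarrow> 'y::real_normed_vector"
  assumes deriv: "has_frechet_derivative V N F A f"
    and int: "f \<in> carrier_interior V N D"
    and lmin: "local_minimizer_on N D (\<lambda>f. 1 / 2 * (norm (F f - g))\<^sup>2 + \<alpha> * N f) f"
    and v: "v \<in> V" "0 \<le> N v"
    and dir: "\<And>t. 0 < t \<Longrightarrow> t \<le> 1 \<Longrightarrow> (- t) *\<^sub>R v \<in> V"
      "\<And>t. 0 < t \<Longrightarrow> t \<le> 1 \<Longrightarrow> f + (- t) *\<^sub>R v \<in> V"
      "\<And>t. 0 < t \<Longrightarrow> t \<le> 1 \<Longrightarrow> N ((- t) *\<^sub>R v) = t * N v"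
      "\<And>t. 0 < t \<Longrightarrow> t \<le> 1 \<Longrightarrow> N (f + (- t) *\<^sub>R v) = N f - t * N v"
  shows "\<alpha> * N v \<le> norm (F f - g) * norm (A v)"
proof -
  define r where "r = norm (F f - g)"
  obtain r1 where r1: "r1 > 0" "\<And>h. h \<in> V \<Longrightarrow> N (h - f) < r1 \<Longrightarrow> h \<in> D"
    using int unfolding carrier_interior_def by blast
  obtain r2 where r2: "r2 > 0" "\<And>h. h \<in> D \<Longrightarrow> N (h - f) < r2 \<Longrightarrow>
      1 / 2 * (norm (F f - g))\<^sup>2 + \<alpha> * N f \<le> 1 / 2 * (norm (F h - g))\<^sup>2 + \<alpha> * N h"
    using lmin unfolding local_minimizer_on_def by blast
  have A: "linear_on_carrier V A"
    using deriv unfolding has_frechet_derivative_def bounded_linear_on_carrier_def by blast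
  have step: "\<alpha> * N v \<le> r * (norm (A v) + \<epsilon> * N v)" if \<epsilon>: "\<epsilon> > 0" for \<epsilon>
  proof -
    define m where "m = norm (A v) + \<epsilon> * N v"
    obtain \<delta> where \<delta>: "\<delta> > 0"
      "\<And>h. h \<in> V \<Longrightarrow> N h < \<delta> \<Longrightarrow> norm (F (f + h) - F f - A h) \<le> \<epsilon> * N h"
      using deriv \<epsilon> unfolding has_frechet_derivative_def by blast
    \<comment> \<open>One radius serves the derivative estimate, the interior of \<open>D\<close>
      and local minimality.\<close>
    define R where "R = min \<delta> (min r1 r2)"
    \<comment> \<open>Smallness of \<open>t * N v\<close> is obtained from a limit, which covers
      \<open>N v = 0\<close> without division.\<close>
    have "((\<lambda>t. t * N v) \<longlongrightarrow> 0 * N v) (at_right (0::real))"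
      by (intro tendsto_intros)
    then have "\<forall>\<^sub>F t in at_right (0::real). t * N v < R"
      using \<delta> r1 r2 by (intro order_tendstoD(2)) (auto simp: R_def)
    moreover have "\<forall>\<^sub>F t in at_right (0::real). 0 < t \<and> t \<le> 1"
      unfolding eventually_at_right_field by (intro exI[of _ 1]) auto
    ultimately have "\<forall>\<^sub>F t in at_right (0::real). \<alpha> * N v \<le> r * m + t / 2 * m\<^sup>2"
    proof eventually_elim
      case (elim t)
      define h where "h = (- t) *\<^sub>R v"
      have h: "h \<in> V" "f + h \<in> V" "N h = t * N v" "N (f + h) = N f - t * N v"
        using dir elim by (auto simp: h_def)
      have small: "N h < \<delta>" "N h < r1" "N h < r2"
        using elim h(3) by (auto simp: R_def)
      have "A h = (- t) *\<^sub>R A v"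
        using A v(1) unfolding linear_on_carrier_def h_def by blast
      then have nA: "norm (A h) = t * norm (A v)" using elim by simp
      \<comment> \<open>Residual at \<open>f\<close>, linear term and Taylor remainder are estimated
        separately.\<close>
      have "F (f + h) - g = (F f - g) + A h + (F (f + h) - F f - A h)" by simp
      then have "norm (F (f + h) - g) \<le> r + norm (A h) + norm (F (f + h) - F f - A h)"
        unfolding r_def by (metis norm_triangle_ineq norm_triangle_mono order_refl)
      also have "\<dots> \<le> r + t * m"
        using \<delta>(2)[OF h(1) small(1)] by (simp add: nA h(3) m_def algebra_simps)
      finally have "(norm (F (f + h) - g))\<^sup>2 \<le> (r + t * m)\<^sup>2"
        by (rule power_mono) simp
      moreover have "f + h \<in> D" using r1(2)[OF h(2)] small by simp
      then have "1 / 2 * r\<^sup>2 + \<alpha> * N f \<le> 1 / 2 * (norm (F (f + h) - g))\<^sup>2 + \<alpha> * N (f + h)"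
        using r2(2) small by (simp add: r_def)
      \<comment> \<open>After expansion of the square, \<open>r\<^sup>2 / 2\<close> and
        \<open>\<alpha> * N f\<close> cancel.\<close>
      ultimately have "t * (\<alpha> * N v) \<le> t * (r * m + t / 2 * m\<^sup>2)"
        unfolding h(4) by (simp add: power2_eq_square algebra_simps)
      then show ?case using elim by simp
    qed
    moreover have "((\<lambda>t. r * m + t / 2 * m\<^sup>2) \<longlongrightarrow> r * m + 0 / 2 * m\<^sup>2) (at_right (0::real))"
      by (intro tendsto_intros) auto
    ultimately show ?thesis
      using tendsto_lowerbound[of _ "r * m + 0 / 2 * m\<^sup>2" "at_right (0::real)" "\<alpha> * N v"]
      by (simp add: m_def)
  qed
  \<comment> \<open>The bound still carries \<open>\<epsilon> * N v\<close>; a second limit removes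
    it.\<close>
  have "((\<lambda>\<epsilon>. r * (norm (A v) + \<epsilon> * N v)) \<longlongrightarrow> r * (norm (A v) + 0 * N v)) (at_right (0::real))"
    by (intro tendsto_intros)
  moreover have "\<forall>\<^sub>F \<epsilon> in at_right (0::real). \<alpha> * N v \<le> r * (norm (A v) + \<epsilon> * N v)"
    using step unfolding eventually_at_right_field by (intro exI[of _ 1]) auto
  ultimately show ?thesis
    using tendsto_lowerbound[of _ "r * (norm (A v) + 0 * N v)" "at_right (0::real)" "\<alpha> * N v"]
    by (simp add: r_def)
qed

section \<open>Vanishing of wavelet coefficients at a local minimizer\<close>

theorem theorem5p1:
  fixes \<Omega> :: "'a::euclidean_space spatial_domain" and sbar :: enat
    and \<Lambda> :: "nat \<Rightarrow> 'k set" and C\<^sub>\<Lambda> :: real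
    and \<phi> \<phi>' :: "nat \<times> 'k \<Rightarrow> 'a \<Rightarrow> real"
    and p pt a \<alpha> K :: real
    and D :: "'a functional set"
    and F :: "'a functional \<Rightarrow> 'y::banach"
    and F' :: "'a functional \<Rightarrow> 'a functional \<Rightarrow> 'y"
    and gobs :: 'y and fhat :: "'a functional"
  defines "Q \<equiv> Q_map \<Omega> sbar \<Lambda> \<phi>'"
    and "Qlev \<equiv> Q_level \<Omega> sbar \<Lambda> \<phi>'"
    and "B \<equiv> B_space \<Omega> sbar \<Lambda> \<phi>'"
    and "nrm \<equiv> B_norm \<Omega> sbar \<Lambda> \<phi>'"
    and "d \<equiv> real DIM('a)"
  defines "D_int \<equiv> carrier_interior (B 0 p 1) (nrm 0 p 1) D"
  assumes "wavelet_system \<Omega> sbar \<Lambda> C\<^sub>\<Lambda> \<phi> \<phi>'"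
    and "\<And>(s::real) (r::ereal) (q::ereal). 1 \<le> r \<Longrightarrow> 1 \<le> q \<Longrightarrow> ereal \<bar>s\<bar> < ereal_of_enat sbar \<Longrightarrow>
           Q ` B s r q = b_space DIM('a) \<Lambda> s r q"
    and "1 \<le> p" and "p \<le> 2"
    and "D \<noteq> {}" and "convex D" and "D \<subseteq> B 0 p 1"
    and "p \<le> pt" and "pt \<le> 2"
    and "d / p - d / pt \<le> a" and "ereal a < ereal_of_enat sbar"
    and "\<And>f. f \<in> D_int \<Longrightarrow> has_frechet_derivative (B 0 p 1) (nrm 0 p 1) F (F' f) f"
    and "uniformly_smooth TYPE('y) \<or> (\<exists>A. linear_on_carrier (B 0 p 1) A \<and> (\<forall>f\<in>D. F f = A f))"
    and "\<alpha> > 0"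
    and "fhat \<in> D_int"
    and "local_minimizer_on (nrm 0 p 1) D
           (\<lambda>f. 1 / 2 * (norm (F f - gobs))\<^sup>2 + \<alpha> * nrm 0 p 1 f) fhat"
    and "\<exists>G. bounded_linear_on_carrier (B (- a) pt 1) (nrm (- a) pt 1) G \<and>
             (\<forall>h\<in>B 0 p 1. G h = F' fhat h) \<and>
             operator_norm (B (- a) pt 1) (nrm (- a) pt 1) G = K"
  shows "(\<forall>j. K / \<alpha> * norm (F fhat - gobs) < 2 powr (real j * (a + d / pt - d / p)) \<longrightarrow>
              (\<forall>k\<in>\<Lambda> j. Qlev j fhat k = 0))
       \<and> (d / p - d / pt < a \<longrightarrow>
            finite {l \<in> index_set \<Lambda>. pairing sbar \<Omega> fhat (\<phi>' l) \<noteq> 0})"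
proof -
  note B = assms(3) and nrm = assms(4)
  have fin: "finite (\<Lambda> j)" for j
    using assms(7) unfolding wavelet_system_def by auto
  have sbar: "1 \<le> sbar"
    using assms(7) unfolding wavelet_system_def by auto
  have p: "0 < p" "0 < pt" using assms(9,14) by auto
  have sbar0: "ereal \<bar>0\<bar> < ereal_of_enat sbar"
    using sbar by (cases sbar) (auto simp: one_enat_def)
  have surj: "Q ` B 0 p 1 = b_space DIM('a) \<Lambda> 0 p 1"
    using assms(8)[of p 1 0] assms(9) sbar0 by (simp add: one_ereal_def)
  obtain G where G: "bounded_linear_on_carrier (B (- a) pt 1) (nrm (- a) pt 1) G"
      "\<And>h. h \<in> B 0 p 1 \<Longrightarrow> G h = F' fhat h"
      "operator_norm (B (- a) pt 1) (nrm (- a) pt 1) G = K"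
    using assms(23) by blast
  have fB: "fhat \<in> B 0 p 1"
    using assms(21) unfolding assms(6) carrier_interior_def by blast
  have B_iff: "h \<in> B s r 1 \<longleftrightarrow> h \<in> distributions_on sbar \<Omega> \<and> Q h \<in> b_space DIM('a) \<Lambda> s r 1"
    for h s r by (simp add: B B_space_def assms(1))
  have nrm_eq: "nrm s r 1 h = b_norm DIM('a) \<Lambda> s r 1 (Q h)" for s r h
    by (simp add: nrm B_norm_def assms(1))
  have Q_ext: "Q h \<in> extensional (index_set \<Lambda>)" for h
    by (simp add: assms(1) Q_map_def)
  have Q_lin: "Q (f + c *\<^sub>R h) l = Q f l + c * Q h l" "Q (c *\<^sub>R h) l = c * Q h l"
    if "l \<in> index_set \<Lambda>" for f h c l
    using that unfolding assms(1) by (rule Q_map_add_scaleR, rule Q_map_scaleR)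
  have scale: "c *\<^sub>R h \<in> B s r 1" "nrm s r 1 (c *\<^sub>R h) = \<bar>c\<bar> * nrm s r 1 h"
    if "0 < r" "h \<in> B s (ereal r) 1" for c h s r
    using b_cmult[OF that(1) Q_ext, of "Q h" "DIM('a)" s "c *\<^sub>R h" c]
      subspace_scale[OF subspace_distributions_on] that(2)
    by (auto simp: B_iff nrm_eq Q_lin)

  have level: "Q fhat (j, k) = 0"
    if "K / \<alpha> * norm (F fhat - gobs) < 2 powr (real j * (a + d / pt - d / p))" "k \<in> \<Lambda> j" for j k
  proof (rule ccontr)
    assume nz: "Q fhat (j, k) \<noteq> 0"
    let ?L = "\<lambda>s r. level_norm DIM('a) \<Lambda> s (ereal r) (Q fhat) j"
    define w where "w = restrict (\<lambda>l. if fst l = j then Q fhat l else 0) (index_set \<Lambda>)"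
    have w: "w \<in> extensional (index_set \<Lambda>)"
      "\<And>i k. k \<in> \<Lambda> i \<Longrightarrow> w (i, k) = (if i = j then Q fhat (i, k) else 0)"
      by (auto simp: w_def)
    note single = b_single_level[where d = "DIM('a)", OF _ w]
    \<comment> \<open>Surjectivity realises the level-\<open>j\<close> part of the coefficients by a
      distribution. It need not be unique; its norms depend only on \<open>w\<close>.\<close>
    obtain v where v: "v \<in> B 0 p 1" "Q v = w"
      using single(1)[OF p(1), of 0] surj by (metis imageE)
    \<comment> \<open>A single level has finite norm in both spaces, so \<open>G\<close> applies to
      \<open>v\<close> and agrees there with the derivative.\<close>
    have v': "v \<in> B (- a) pt 1"
      using v single(1)[OF p(2)] by (simp add: B_iff)
    have nv: "nrm 0 p 1 v = ?L 0 p" "nrm (- a) pt 1 v = ?L (- a) pt"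
      using single(2) p by (simp_all add: nrm_eq v(2))
    have shrink: "fhat + (- t) *\<^sub>R v \<in> B 0 p 1"
        "nrm 0 p 1 (fhat + (- t) *\<^sub>R v) = nrm 0 p 1 fhat - t * nrm 0 p 1 v"
      if "0 < t" "t \<le> 1" for t
    proof -
      define u where "u = fhat + (- t) *\<^sub>R v"
      have "Q u (i, k) = (if i = j then (1 - t) * Q fhat (i, k) else Q fhat (i, k))"
        if "k \<in> \<Lambda> i" for i k
        using Q_lin(1)[of "(i, k)" fhat "- t" v, folded u_def] that w(2)[OF that] v(2)
        by (auto simp: algebra_simps split: if_splits)
      note b_shrink_level[OF p(1) Q_ext _ \<open>t \<le> 1\<close> this, where d = "DIM('a)" and s = 0]
      moreover have "u \<in> distributions_on sbar \<Omega>"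
        unfolding u_def using fB v(1)
        by (intro subspace_add subspace_scale subspace_distributions_on) (auto simp: B_iff)
      ultimately have "u \<in> B 0 p 1" "nrm 0 p 1 u = nrm 0 p 1 fhat - t * nrm 0 p 1 v"
        using fB unfolding nv by (auto simp: B_iff nrm_eq)
      then show "fhat + (- t) *\<^sub>R v \<in> B 0 p 1"
        "nrm 0 p 1 (fhat + (- t) *\<^sub>R v) = nrm 0 p 1 fhat - t * nrm 0 p 1 v"
        unfolding u_def .
    qed
    have "\<alpha> * nrm 0 p 1 v \<le> norm (F fhat - gobs) * norm (F' fhat v)"
    proof (rule local_minimizer_first_order[where F = F and f = fhat and D = D
          and A = "F' fhat" and V = "B 0 p 1" and N = "nrm 0 p 1"])
      show "has_frechet_derivative (B 0 p 1) (nrm 0 p 1) F (F' fhat) fhat"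
        using assms(18,21) by blast
      show "fhat \<in> carrier_interior (B 0 p 1) (nrm 0 p 1) D"
        using assms(21) by (simp add: assms(6))
      show "local_minimizer_on (nrm 0 p 1) D
          (\<lambda>f. 1 / 2 * (norm (F f - gobs))\<^sup>2 + \<alpha> * nrm 0 p 1 f) fhat"
        by (fact assms(22))
      show "0 \<le> nrm 0 p 1 v" by (simp add: nrm_eq b_norm_1_nonneg)
      show "(- t) *\<^sub>R v \<in> B 0 p 1" for t
        by (rule scale(1)[OF p(1) v(1)])
      show "nrm 0 p 1 ((- t) *\<^sub>R v) = t * nrm 0 p 1 v" if "0 < t" for t
        using scale(2)[OF p(1) v(1), of "- t"] that by simp
    qed (rule v(1), rule shrink(1), assumption+, rule shrink(2), assumption+)
    also have "norm (F' fhat v) \<le> K * nrm (- a) pt 1 v"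
      using norm_le_operator_norm[OF G(1) v'] scale[OF p(2) v']
      by (simp add: G(2)[OF v(1)] G(3) nrm_eq b_norm_1_nonneg)
    finally have "\<alpha> * ?L 0 p \<le> norm (F fhat - gobs) * (K * ?L (- a) pt)"
      unfolding nv by (simp add: mult_left_mono)
    then have ub: "?L 0 p \<le> K / \<alpha> * norm (F fhat - gobs) * ?L (- a) pt"
      using assms(20) by (simp add: field_simps)
    \<comment> \<open>Only here does the nonzero coefficient enter: it makes the level norm
      positive, so multiplying the strict hypothesis by it contradicts the two bounds on
      \<open>?L 0 p\<close>.\<close>
    have "?L (- a) pt \<noteq> 0"
      unfolding level_norm_eq_0_iff[OF p(2) fin] using nz \<open>k \<in> \<Lambda> j\<close> by blast
    then have pos: "0 < ?L (- a) pt"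
      using level_norm_nonneg[of "DIM('a)" \<Lambda> "- a" pt "Q fhat" j] by simp
    have "2 powr (real j * (a + d / pt - d / p)) * ?L (- a) pt \<le> ?L 0 p"
      using level_norm_embedding[OF p(1) assms(14) fin] by (simp add: assms(5))
    also note ub
    finally show False using mult_strict_right_mono[OF that(1) pos] by simp
  qed

  have "finite {l \<in> index_set \<Lambda>. pairing sbar \<Omega> fhat (\<phi>' l) \<noteq> 0}" if gap: "d / p - d / pt < a"
  proof -
    \<comment> \<open>For \<open>e > 0\<close> the thresholds \<open>2 powr (real j * e)\<close>
      grow without bound, so all levels from some \<open>J\<close> on vanish and finitely many
      finite levels remain. At \<open>e = 0\<close> every threshold equals 1.\<close>
    define e where "e = a + d / pt - d / p"
    have "0 < e" using gap by (simp add: e_def)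
    obtain J where J: "K / \<alpha> * norm (F fhat - gobs) < (2 powr e) ^ J"
      using real_arch_pow[of "2 powr e"] \<open>0 < e\<close> by auto
    have "{l \<in> index_set \<Lambda>. pairing sbar \<Omega> fhat (\<phi>' l) \<noteq> 0} \<subseteq> (SIGMA j:{..<J}. \<Lambda> j)"
    proof clarsimp
      fix j k assume k: "k \<in> \<Lambda> j" "pairing sbar \<Omega> fhat (\<phi>' (j, k)) \<noteq> 0"
      show "j < J"
      proof (rule ccontr)
        assume "\<not> j < J"
        then have "(2 powr e) ^ J \<le> (2 powr e) ^ j"
          using \<open>0 < e\<close> by (intro power_increasing) (auto simp: ge_one_powr_ge_zero)
        also have "\<dots> = 2 powr (real j * e)"
          by (simp add: powr_power mult.commute)
        finally have "Q fhat (j, k) = 0" using J level[OF _ k(1)] by (simp add: e_def)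
        then show False using k by (simp add: assms(1) Q_map_def)
      qed
    qed
    then show ?thesis using fin by (auto intro: finite_subset)
  qed
  moreover have "Qlev j fhat k = Q fhat (j, k)" if "k \<in> \<Lambda> j" for j k
    using that by (simp add: assms(1,2) Q_level_def Q_map_def)
  ultimately show ?thesis using level by auto
qed

end
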